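(* Let $\gamma=b_1^{-2}\alpha_1^{-1}$ with $b_1=2$ and $\alpha_1=3$ (so $\gamma=1/12$), and let $\xi>0$. (a) Let $F\subset\mathbb{R}^2$, let $A$ be any subset of the $x$-axis, let $s,t\ge 0$, and suppose that for some constant $c$ one has $\mathsf{H}^t(F_x)>c$ for every $x\in A$. If in addition $F$ is $\xi$-regular, then $$\mathsf{H}^{s+t}(F)\ge\gamma\,\xi^{-1}c\,\mathsf{H}^s(A).$$ (b) In particular, if $A,B\subset\mathbb{R}$ and $F=A\times B$ is $\xi$-regular, then for $s,t\ge 0$ $$\mathsf{H}^{s+t}(A\times B)\ge\gamma\,\xi^{-1}\,\mathsf{H}^s(A)\,\mathsf{H}^t(B),$$ and thus $$\dim_{MB}(A\times B)\ge\dim_{MB}A+\dim_{MB}B.$$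
   Context: $\mathbb{R}^n$ carries the Euclidean distance; $B(x,r)$ is the closed ball of centre $x$ and radius $r$. For $E\subset\mathbb{R}^n$ and $r>0$, $N_r(E)$ is the infimum of the numbers of elements of families of closed balls $(B(x_i,r))_{i\in I}$ with $x_i\in E$ and $E\subseteq\bigcup_iB(x_i,r)$. For $t\ge 0$, $\overline{\mathsf{H}}^t_r(E)=N_r(E)(2r)^t$, the Hewitt-Stromberg premeasure is $\overline{\mathsf{H}}^t(E)=\liminf_{r\to0}\overline{\mathsf{H}}^t_r(E)$, and the Hewitt-Stromberg measure is $$\mathsf{H}^t(E)=\inf\Big\{\sum_i\overline{\mathsf{H}}^t(E_i) : E\subseteq\bigcup_iE_i\Big\},$$ over countable covers. The Hewitt-Stromberg dimension is $\dim_{MB}E=\sup\{t\ge0:\mathsf{H}^t(E)=+\infty\}=\inf\{t\ge0:\mathsf{H}^t(E)=0\}$. For $\xi>0$, a set $E$ is $\xi$-regular if $\overline{\mathsf{H}}^t(E)=\xi\,\mathsf{H}^t(E)$ for every $t\ge 0$. For $F\subset\mathbb{R}^2$, $F_x$ denotes the set of points of $F$ whose abscissa is $x$; points of the $x$-axis are identified with real numbers. Convention: $0\cdot\infty=0$.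
   Formalization: The dimension inequality in (b) is stated only for nonempty A and B; with the given definition the empty set has dimension 0, so for A empty and B = [0,1] the inequality as written would read 0 ≥ 1. *)

theory Defs
  imports "HOL-Analysis.Analysis"
begin

(* Only finite families are listed: an infinite one has infinitely many elements, and the infimum
   over the empty set is already \<infinity> in ennreal.  Repeated centres never lower the count, so a family
   is represented by the set C of its centres. *)
definition covering_number :: "real \<Rightarrow> 'a::euclidean_space set \<Rightarrow> ennreal" where
  "covering_number r E =
     (INF C \<in> {C. finite C \<and> C \<subseteq> E \<and> E \<subseteq> (\<Union>x\<in>C. cball x r)}. of_nat (card C))"

definition hs_pre_at :: "real \<Rightarrow> real \<Rightarrow> 'a::euclidean_space set \<Rightarrow> ennreal" where
  "hs_pre_at t r E = covering_number r E * ennreal ((2 * r) powr t)"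

definition hs_premeasure :: "real \<Rightarrow> 'a::euclidean_space set \<Rightarrow> ennreal" where
  "hs_premeasure t E = Liminf (at_right 0) (\<lambda>r. hs_pre_at t r E)"

(* Finite covers are included: they are padded with empty sets, whose premeasure is 0.
   The covering sets need not be subsets of E, and hs_premeasure is not monotone. *)
definition hs_measure :: "real \<Rightarrow> 'a::euclidean_space set \<Rightarrow> ennreal" where
  "hs_measure t E =
     (INF U \<in> {U :: nat \<Rightarrow> 'a set. E \<subseteq> (\<Union>i. U i)}. \<Sum>i. hs_premeasure t (U i))"

(* In ennreal the supremum of the empty set is 0; hs_dim_eq_Inf below gives the dual form. *)
definition hs_dim :: "'a::euclidean_space set \<Rightarrow> ennreal" where
  "hs_dim E = Sup {ennreal t | t. 0 \<le> t \<and> hs_measure t E = \<infinity>}"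

definition xi_regular :: "real \<Rightarrow> 'a::euclidean_space set \<Rightarrow> bool" where
  "xi_regular \<xi> E \<longleftrightarrow> (\<forall>t\<ge>0. hs_premeasure t E = ennreal \<xi> * hs_measure t E)"

definition vsection :: "(real \<times> real) set \<Rightarrow> real \<Rightarrow> (real \<times> real) set" where
  "vsection F x = {p \<in> F. fst p = x}"

lemma hs_premeasure_empty: "hs_premeasure t {} = 0"
proof -
  have "covering_number r ({} :: 'a set) \<le> of_nat (card ({} :: 'a set))" for r
    unfolding covering_number_def by (rule INF_lower) auto
  then show ?thesis
    by (simp add: hs_premeasure_def hs_pre_at_def Liminf_const)
qed

lemma hs_premeasure_exponent:
  assumes "t < s" and fin: "hs_premeasure t E < \<infinity>"
  shows "hs_premeasure s E = 0"
proof (rule ccontr)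
  assume "hs_premeasure s E \<noteq> 0"
  then have "0 < hs_premeasure s E" by (simp add: zero_less_iff_neq_zero)
  then obtain e where e: "0 < e" "e < hs_premeasure s E" using dense by blast
  obtain M where M: "hs_premeasure t E < M" "M < \<infinity>" using fin dense by blast
  from e(2) have ev1: "eventually (\<lambda>r. e < hs_pre_at s r E) (at_right 0)"
    unfolding hs_premeasure_def by (rule less_LiminfD)
  have "((\<lambda>r::real. (2 * r) powr (s - t)) \<longlongrightarrow> 0) (at_right 0)"
  proof -
    have "((\<lambda>r::real. (2 * r) powr (s - t)) \<longlongrightarrow> (2 * 0) powr (s - t)) (at_right 0)"
      using \<open>t < s\<close> by (intro tendsto_powr' tendsto_intros)
        (auto simp: eventually_at_right_less eventually_at_filter)
    then show ?thesis by simp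
  qed
  then have "((\<lambda>r. ennreal ((2 * r) powr (s - t))) \<longlongrightarrow> ennreal 0) (at_right 0)"
    by (rule tendsto_ennrealI)
  then have "((\<lambda>r. M * ennreal ((2 * r) powr (s - t))) \<longlongrightarrow> M * 0) (at_right 0)"
    using M(2) by (intro ennreal_tendsto_cmult) (auto simp: infinity_ennreal_def)
  then have ev2: "eventually (\<lambda>r. M * ennreal ((2 * r) powr (s - t)) < e) (at_right 0)"
    using e(1) by (auto dest: order_tendstoD(2))
  have "eventually (\<lambda>r. M \<le> hs_pre_at t r E) (at_right 0)"
    using ev1 ev2 eventually_at_right_less[of 0]
  proof eventually_elim
    case (elim r)
    show ?case
    proof (rule ccontr)
      assume "\<not> M \<le> hs_pre_at t r E"
      then have "hs_pre_at t r E * ennreal ((2 * r) powr (s - t))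
          \<le> M * ennreal ((2 * r) powr (s - t))"
        by (intro mult_right_mono) auto
      moreover have "hs_pre_at s r E = hs_pre_at t r E * ennreal ((2 * r) powr (s - t))"
        using elim(3) by (simp add: hs_pre_at_def mult.assoc powr_diff flip: ennreal_mult)
      ultimately show False using elim(1,2) by simp
    qed
  qed
  then have "M \<le> hs_premeasure t E"
    unfolding hs_premeasure_def by (rule Liminf_bounded)
  with M(1) show False by simp
qed

lemma hs_measure_exponent:
  assumes "t < s" and fin: "hs_measure t E < \<infinity>"
  shows "hs_measure s E = 0"
proof -
  obtain U :: "nat \<Rightarrow> 'a set" where U: "E \<subseteq> (\<Union>i. U i)" "(\<Sum>i. hs_premeasure t (U i)) < \<infinity>"
    using fin unfolding hs_measure_def INF_less_iff by auto
  have "hs_premeasure t (U i) < \<infinity>" for i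
    using U(2) ennreal_suminf_lessD by blast
  then have "hs_premeasure s (U i) = 0" for i
    using \<open>t < s\<close> hs_premeasure_exponent by blast
  then have "(\<Sum>i. hs_premeasure s (U i)) = 0" by simp
  moreover have "hs_measure s E \<le> (\<Sum>i. hs_premeasure s (U i))"
    unfolding hs_measure_def using U(1) by (intro INF_lower) auto
  ultimately show ?thesis by simp
qed

lemma hs_dim_eq_Inf: "hs_dim E = Inf {ennreal t | t. 0 \<le> t \<and> hs_measure t E = 0}"
proof (rule antisym)
  have "t \<le> u" if "0 \<le> t" "hs_measure t E = \<infinity>" "0 \<le> u" "hs_measure u E = 0" for t u
  proof (rule ccontr)
    assume "\<not> t \<le> u"
    then have "hs_measure t E = 0"
      using that by (intro hs_measure_exponent[of u t]) auto
    then show False using that by simp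
  qed
  then show "hs_dim E \<le> Inf {ennreal t | t. 0 \<le> t \<and> hs_measure t E = 0}"
    unfolding hs_dim_def by (intro Sup_least Inf_greatest) (auto intro: ennreal_leI)
next
  show "Inf {ennreal t | t. 0 \<le> t \<and> hs_measure t E = 0} \<le> hs_dim E"
  proof (rule dense_le)
    fix y assume y: "y < Inf {ennreal t | t. 0 \<le> t \<and> hs_measure t E = 0}"
    then obtain z where z: "y < z" "z < Inf {ennreal t | t. 0 \<le> t \<and> hs_measure t E = 0}"
      using dense by blast
    have "z < top" using z(2) by (rule order.strict_trans2) simp
    then obtain a where a: "z = ennreal a" "0 \<le> a" by (cases z) auto
    have "y < top" using z(1) \<open>z < top\<close> by (rule less_trans)
    then obtain b where b: "y = ennreal b" "0 \<le> b" by (cases y) auto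
    have "b < a" using z(1) a b by (simp add: ennreal_less_iff)
    have "hs_measure a E \<noteq> 0"
    proof
      assume "hs_measure a E = 0"
      then have "Inf {ennreal t | t. 0 \<le> t \<and> hs_measure t E = 0} \<le> z"
        using a by (intro Inf_lower) auto
      with z(2) show False by simp
    qed
    then have "hs_measure b E = \<infinity>"
      using hs_measure_exponent[OF \<open>b < a\<close>, of E]
      by (metis infinity_ennreal_def top.not_eq_extremum)
    then show "y \<le> hs_dim E"
      unfolding hs_dim_def using b by (intro Sup_upper) auto
  qed
qed

end

(* Let A_n be the set of x in A with c <= N_r(F_x) (2r)^t for all r < 1/n.  Given a cover of F by
   N balls of radius r < 1/n, each section over A_n meets at least c (2r)^(-t) / 2 of them, and
   balls meeting sections at abscissas more than 2r apart are distinct.  A maximal 2r-separated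
   subset of A_n therefore yields a cover of A_n by at most 4 N (2r)^t / c intervals of length 2r.

   To pass from A_n to A one needs an increasing sets lemma, which is not available directly since
   the premeasure is not monotone.  On the line, admitting arbitrary centres costs at most a factor
   2 and gives a monotone, closure-invariant premeasure.  For s > 0 cutting a set at a point adds
   only O((2r)^s) to it, so half-lines are Caratheodory measurable for the induced outer measure,
   which is thus Borel regular.  For s = 0 finite subsets of A suffice.  Altogether
   c H^s(A) is at most 8 times the premeasure of F. *)

theory Submission
  imports Defs
begin

section \<open>Infima and limits in the extended nonnegative reals\<close>

text \<open>The infimum over an empty family is \<open>top\<close>, so a finite infimum has
  candidates, and natural numbers are well ordered. It turns a finite covering number into an actual
  optimal cover.\<close>

lemma INF_of_nat_attained:
  assumes "(INF x\<in>S. of_nat (f x) :: ennreal) \<noteq> top"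
  obtains x where "x \<in> S" "(INF x\<in>S. of_nat (f x) :: ennreal) = of_nat (f x)"
proof -
  have "S \<noteq> {}" using assms by auto
  then obtain x where x: "x \<in> S" "\<forall>y. y \<in> S \<longrightarrow> f x \<le> f y"
    using ex_has_least_nat[of "\<lambda>x. x \<in> S" _ f] by blast
  then have "(INF x\<in>S. of_nat (f x) :: ennreal) = of_nat (f x)"
    by (intro antisym INF_lower INF_greatest) auto
  with x(1) show ?thesis by (rule that)
qed

text \<open>Multiplication by a finite constant is monotone and continuous; for
  \<open>c = top\<close> continuity fails at 0.\<close>

lemma Liminf_cmult_ennreal:
  fixes f :: "'a \<Rightarrow> ennreal"
  assumes "F \<noteq> bot" "c < top"
  shows "Liminf F (\<lambda>x. c * f x) = c * Liminf F f"
proof (rule Liminf_compose_continuous_mono)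
  show "continuous_on UNIV (\<lambda>y. c * y)"
    by (rule ennreal_continuous_on_cmult[OF assms(2) continuous_on_id])
  show "mono (\<lambda>y. c * y)" by (rule monoI) (simp add: mult_left_mono)
qed (rule assms)

text \<open>Any \<open>y\<close> below the first lower limit is eventually below \<open>f\<close>,
  so \<open>f\<close> may be replaced by the constant \<open>y\<close>, which moves out of the
  limit; then take the supremum over \<open>y\<close>.\<close>

lemma Liminf_add_le_ennreal:
  fixes f g :: "'a \<Rightarrow> ennreal"
  assumes "F \<noteq> bot"
  shows "Liminf F f + Liminf F g \<le> Liminf F (\<lambda>x. f x + g x)"
\<comment> \<open>If the first limit is 0, no \<open>y\<close> lies below it, and a sum can be moved
  inside a supremum only over a nonempty index set.\<close>
proof (cases "Liminf F f = 0")
  case True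
  then show ?thesis by (auto intro!: Liminf_mono always_eventually)
next
  case False
  then have "0 \<in> {..<Liminf F f}" by (simp add: zero_less_iff_neq_zero)
  then have "{..<Liminf F f} \<noteq> {}" by blast
  moreover have "(SUP y\<in>{..<Liminf F f}. y) = Liminf F f"
    by (simp add: Sup_lessThan)
  ultimately have "Liminf F f + Liminf F g = (SUP y\<in>{..<Liminf F f}. y + Liminf F g)"
    by (simp add: ennreal_SUP_add_left)
  also have "\<dots> \<le> Liminf F (\<lambda>x. f x + g x)"
  proof (rule SUP_least)
    fix y assume "y \<in> {..<Liminf F f}"
    then have "eventually (\<lambda>x. y < f x) F" using less_LiminfD by auto
    then have "Liminf F (\<lambda>x. y + g x) \<le> Liminf F (\<lambda>x. f x + g x)"
      by (intro Liminf_mono) (auto elim!: eventually_mono intro: add_mono)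
    then show "y + Liminf F g \<le> Liminf F (\<lambda>x. f x + g x)"
      using assms by (simp add: Liminf_const_add)
  qed
  finally show ?thesis .
qed

section \<open>The increasing sets lemma for outer measures on the line\<close>

text \<open>Replacing the members of a cover by their closures costs nothing, so nearly optimal
  covers may be taken closed. Intersecting a sequence of them with errors tending to 0 gives a
  countable intersection of F-sigma sets with the same outer measure.\<close>

lemma outer_measure_Borel_hull:
  fixes f :: "real set \<Rightarrow> ennreal"
  assumes pos: "positive UNIV f" and inc: "increasing UNIV f"
    and closure: "\<And>E. f (closure E) = f E"
  obtains B where "B \<in> sets borel" "E \<subseteq> B" "outer_measure UNIV f B = outer_measure UNIV f E"
proof (cases "outer_measure UNIV f E = top")
  case True
  interpret ring_of_sets UNIV UNIV using ring_of_sets_Pow[of UNIV] by simp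
  \<comment> \<open>With infinite outer measure the whole line is already a hull.\<close>
  have "outer_measure UNIV f E \<le> outer_measure UNIV f UNIV"
    using increasing_outer_measure[of f] by (auto simp: increasing_def)
  with True show ?thesis by (intro that[of UNIV]) (auto simp: top_unique)
next
  case False
  interpret ring_of_sets UNIV UNIV using ring_of_sets_Pow[of UNIV] by simp
  let ?\<mu> = "outer_measure UNIV f"
  have "\<forall>n. \<exists>U :: nat \<Rightarrow> real set. E \<subseteq> (\<Union>i. U i) \<and> (\<Sum>i. f (U i)) < ?\<mu> E + ennreal (1 / Suc n)"
  proof
    fix n
    have "?\<mu> E < ?\<mu> E + ennreal (1 / Suc n)"
      using ennreal_add_left_cancel_less[of "?\<mu> E" 0 "ennreal (1 / Suc n)"] False by auto
    from outer_measure_close[OF this]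
    show "\<exists>U :: nat \<Rightarrow> real set. E \<subseteq> (\<Union>i. U i) \<and> (\<Sum>i. f (U i)) < ?\<mu> E + ennreal (1 / Suc n)"
      by blast
  qed
  from choice[OF this] obtain U :: "nat \<Rightarrow> nat \<Rightarrow> real set" where
    U: "\<And>n. E \<subseteq> (\<Union>i. U n i)" "\<And>n. (\<Sum>i. f (U n i)) < ?\<mu> E + ennreal (1 / Suc n)"
    by blast
  define B where "B = (\<Inter>n. \<Union>i. closure (U n i))"
  have E: "E \<subseteq> B"
    unfolding B_def
  proof (rule INT_greatest)
    fix n
    have "(\<Union>i. U n i) \<subseteq> (\<Union>i. closure (U n i))"
      by (intro UN_mono closure_subset order_refl)
    with U(1) show "E \<subseteq> (\<Union>i. closure (U n i))" by (rule order_trans)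
  qed
  have "?\<mu> B \<le> ?\<mu> E + ennreal (1 / Suc n)" for n
  proof -
    have "?\<mu> B \<le> (\<Sum>i. f (closure (U n i)))"
      by (rule outer_measure_le[OF pos inc]) (auto simp: B_def)
    also have "\<dots> \<le> ?\<mu> E + ennreal (1 / Suc n)"
      using U(2)[of n] by (simp add: closure)
    finally show ?thesis .
  qed
  moreover have "(\<lambda>n. ?\<mu> E + ennreal (1 / Suc n)) \<longlonglongrightarrow> ?\<mu> E + ennreal 0"
    by (intro tendsto_add tendsto_const tendsto_ennrealI LIMSEQ_Suc lim_1_over_n)
  ultimately have "?\<mu> B \<le> ?\<mu> E"
    by (intro LIMSEQ_le_const[of "\<lambda>n. ?\<mu> E + ennreal (1 / Suc n)"]) auto
  moreover have "?\<mu> E \<le> ?\<mu> B"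
    using increasing_outer_measure[of f] E by (auto simp: increasing_def)
  ultimately show ?thesis
    using E by (intro that[of B]) (auto simp: B_def)
qed

text \<open>Cutting every member of a cover at \<open>a\<close> transfers \<open>split\<close> from
  \<open>f\<close> to the outer measure. Half-lines are thus Caratheodory measurable, and they
  generate the Borel sets.\<close>

lemma outer_measure_measure_space_borel:
  fixes f :: "real set \<Rightarrow> ennreal"
  assumes pos: "positive UNIV f" and inc: "increasing UNIV f"
    and split: "\<And>E a. f (E \<inter> {..a}) + f (E - {..a}) \<le> f E"
  shows "measure_space UNIV (sets borel) (outer_measure UNIV f)"
proof -
  interpret sigma_algebra UNIV "UNIV :: real set set" using sigma_algebra_Pow[of UNIV] by simp
  let ?\<mu> = "outer_measure UNIV f"
  have oms: "outer_measure_space UNIV ?\<mu>"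
    using outer_measure_space_outer_measure[OF pos inc] by simp
  then have sub: "subadditive UNIV ?\<mu>"
    using countably_subadditive_subadditive unfolding outer_measure_space_def by blast
  have ms: "measure_space UNIV (lambda_system UNIV UNIV ?\<mu>) ?\<mu>"
    by (rule caratheodory_lemma[OF oms])
  have "{..a} \<in> lambda_system UNIV UNIV ?\<mu>" for a
    unfolding lambda_system_eq
  proof (safe intro!: antisym)
    fix E :: "real set"
    show "?\<mu> (E \<inter> {..a}) + ?\<mu> (E - {..a}) \<le> ?\<mu> E"
      unfolding outer_measure_def[of _ _ E]
    proof (safe intro!: INF_greatest)
      fix U :: "nat \<Rightarrow> real set" assume U: "E \<subseteq> (\<Union>i. U i)"
      have "?\<mu> (E \<inter> {..a}) \<le> (\<Sum>i. f (U i \<inter> {..a}))"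
        using U by (intro outer_measure_le[OF pos inc]) auto
      moreover have "?\<mu> (E - {..a}) \<le> (\<Sum>i. f (U i - {..a}))"
        using U by (intro outer_measure_le[OF pos inc]) auto
      ultimately have "?\<mu> (E \<inter> {..a}) + ?\<mu> (E - {..a})
          \<le> (\<Sum>i. f (U i \<inter> {..a}) + f (U i - {..a}))"
        by (subst suminf_add[symmetric]) (auto intro: add_mono)
      also have "\<dots> \<le> (\<Sum>i. f (U i))"
        by (intro suminf_le split) auto
      finally show "?\<mu> (E \<inter> {..a}) + ?\<mu> (E - {..a}) \<le> (\<Sum>i. f (U i))" .
    qed
    show "?\<mu> E \<le> ?\<mu> (E \<inter> {..a}) + ?\<mu> (E - {..a})"
      using subadditiveD[OF sub, of "E \<inter> {..a}" "E - {..a}"] by (auto simp: Int_Diff_Un)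
  qed auto
  then have "range (\<lambda>a::real. {..a}) \<subseteq> lambda_system UNIV UNIV ?\<mu>" by auto
  then have "sigma_sets UNIV (range (\<lambda>a::real. {..a})) \<subseteq> lambda_system UNIV UNIV ?\<mu>"
    using ms by (intro sigma_algebra.sigma_sets_subset) (auto simp: measure_space_def)
  then have "sets borel \<subseteq> lambda_system UNIV UNIV ?\<mu>"
    by (subst borel_eq_atMost) auto
  then show ?thesis
    using sets.sigma_algebra_axioms[of "borel :: real measure"] by (intro measure_down[OF ms]) auto
qed

text \<open>Arbitrary increasing sets are enlarged to increasing Borel sets of no larger outer
  measure, on which the outer measure is a genuine measure and hence continuous from below.\<close>

lemma outer_measure_UN_incseq:
  fixes f :: "real set \<Rightarrow> ennreal"
  assumes pos: "positive UNIV f" and inc: "increasing UNIV f"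
    and closure: "\<And>E. f (closure E) = f E"
    and split: "\<And>E a. f (E \<inter> {..a}) + f (E - {..a}) \<le> f E"
    and A: "incseq A"
  shows "outer_measure UNIV f (\<Union>n. A n) \<le> (SUP n. outer_measure UNIV f (A n))"
proof -
  interpret ring_of_sets UNIV UNIV using ring_of_sets_Pow[of UNIV] by simp
  let ?\<mu> = "outer_measure UNIV f"
  have mono: "?\<mu> X \<le> ?\<mu> Y" if "X \<subseteq> Y" for X Y
    using increasing_outer_measure[of f] that by (auto simp: increasing_def)
  have "\<exists>B. B \<in> sets borel \<and> A n \<subseteq> B \<and> ?\<mu> B = ?\<mu> (A n)" for n
    using outer_measure_Borel_hull[OF pos inc closure, of "A n"] by metis
  then obtain B where B: "\<And>n. B n \<in> sets borel" "\<And>n. A n \<subseteq> B n" "\<And>n. ?\<mu> (B n) = ?\<mu> (A n)"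
    by metis
  \<comment> \<open>The hulls \<open>B n\<close> need not increase; intersecting the tails restores
    monotonicity. \<open>C n\<close> still contains \<open>A n\<close>, since \<open>A n\<close>
    lies in \<open>A m\<close> and so in \<open>B m\<close> for all later \<open>m\<close>.\<close>
  define C where "C n = (\<Inter>m\<in>{n..}. B m)" for n
  have C: "range C \<subseteq> sets borel" "incseq C"
    unfolding C_def using B(1) by (auto simp: incseq_def intro!: sets.countable_INT'')
  have AC: "A n \<subseteq> C n" for n
    unfolding C_def using B(2) A by (auto simp: incseq_def) blast
  let ?M = "measure_of UNIV (sets borel) ?\<mu>"
  have ms: "measure_space UNIV (sets borel) ?\<mu>"
    by (rule outer_measure_measure_space_borel[OF pos inc split])
  have em: "emeasure ?M X = ?\<mu> X" if "X \<in> sets borel" for X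
    using ms that by (intro emeasure_measure_of_sigma) (auto simp: measure_space_def)
  have "?\<mu> (\<Union>n. A n) \<le> ?\<mu> (\<Union>n. C n)" using AC by (intro mono) blast
  also have "\<dots> = emeasure ?M (\<Union>n. C n)" using C(1) by (intro em[symmetric]) auto
  also have "\<dots> = (SUP n. emeasure ?M (C n))"
    using C by (intro SUP_emeasure_incseq[symmetric]) (auto simp: sets.sigma_sets_eq)
  also have "\<dots> = (SUP n. ?\<mu> (C n))"
    using C(1) by (intro SUP_cong em) auto
  also have "\<dots> \<le> (SUP n. ?\<mu> (A n))"
  proof (rule SUP_mono)
    fix n
    have "?\<mu> (C n) \<le> ?\<mu> (B n)" by (intro mono) (auto simp: C_def)
    then show "\<exists>m\<in>UNIV. ?\<mu> (C n) \<le> ?\<mu> (A m)" using B(3) by auto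
  qed
  finally show ?thesis .
qed

section \<open>Covering numbers with unrestricted centres\<close>

text \<open>A piece of diameter at most \<open>r\<close> lies in the ball about any of its points,
  so each piece meeting \<open>E\<close> can supply a centre belonging to \<open>E\<close>. This is
  how covers with foreign centres become admissible.\<close>

lemma covering_number_le_card_pieces:
  assumes "finite I" and "E \<subseteq> (\<Union>i\<in>I. S i)"
    and "\<And>i x y. i \<in> I \<Longrightarrow> x \<in> E \<inter> S i \<Longrightarrow> y \<in> E \<inter> S i \<Longrightarrow> dist x y \<le> r"
  shows "covering_number r E \<le> of_nat (card I)"
proof -
  define J where "J = {i \<in> I. E \<inter> S i \<noteq> {}}"
  have "finite J" using assms(1) by (simp add: J_def)
  have "\<forall>i\<in>J. \<exists>x. x \<in> E \<inter> S i" by (auto simp: J_def)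
  then obtain p where p: "\<And>i. i \<in> J \<Longrightarrow> p i \<in> E \<inter> S i" by metis
  have "E \<subseteq> (\<Union>x\<in>p ` J. cball x r)"
  proof
    fix x assume "x \<in> E"
    then obtain i where i: "i \<in> I" "x \<in> E \<inter> S i" using assms(2) by blast
    then have "i \<in> J" by (auto simp: J_def)
    then have "p i \<in> E \<inter> S i" by (rule p)
    then have "dist (p i) x \<le> r" using assms(3) i by blast
    with \<open>i \<in> J\<close> show "x \<in> (\<Union>x\<in>p ` J. cball x r)" by auto
  qed
  then have "covering_number r E \<le> of_nat (card (p ` J))"
    unfolding covering_number_def using \<open>finite J\<close> p by (intro INF_lower) auto
  also have "card (p ` J) \<le> card I"
    using card_image_le[OF \<open>finite J\<close>, of p] card_mono[of I J] assms(1) by (auto simp: J_def)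
  finally show ?thesis by simp
qed

lemma covering_number_ge_1:
  assumes "E \<noteq> {}"
  shows "1 \<le> covering_number r E"
  unfolding covering_number_def
proof (rule INF_greatest)
  fix C assume "C \<in> {C. finite C \<and> C \<subseteq> E \<and> E \<subseteq> (\<Union>x\<in>C. cball x r)}"
  then have "1 \<le> card C" using assms by (auto simp: Suc_le_eq card_gt_0_iff)
  then show "(1::ennreal) \<le> of_nat (card C)" using of_nat_mono[of 1] by fastforce
qed

text \<open>Dropping the condition that centres lie in \<open>E\<close> makes the count monotone in
  \<open>E\<close>, which \<open>covering_number\<close> is not.\<close>

definition free_covering_number :: "real \<Rightarrow> real set \<Rightarrow> ennreal" where
  "free_covering_number r E = (INF C \<in> {C. finite C \<and> E \<subseteq> (\<Union>x\<in>C. cball x r)}. of_nat (card C))"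

lemma free_covering_number_le:
  "finite C \<Longrightarrow> E \<subseteq> (\<Union>x\<in>C. cball x r) \<Longrightarrow> free_covering_number r E \<le> of_nat (card C)"
  unfolding free_covering_number_def by (rule INF_lower) auto

lemma free_covering_number_attained:
  assumes "free_covering_number r E \<noteq> top"
  obtains C where "finite C" "E \<subseteq> (\<Union>x\<in>C. cball x r)" "free_covering_number r E = of_nat (card C)"
proof -
  let ?S = "{C. finite C \<and> E \<subseteq> (\<Union>x\<in>C. cball x r)}"
  obtain C where "C \<in> ?S" "(INF C\<in>?S. of_nat (card C) :: ennreal) = of_nat (card C)"
    using assms unfolding free_covering_number_def by (rule INF_of_nat_attained)
  then show ?thesis by (intro that[of C]) (simp_all add: free_covering_number_def)
qed

lemma free_covering_number_mono: "E \<subseteq> E' \<Longrightarrow> free_covering_number r E \<le> free_covering_number r E'"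
  unfolding free_covering_number_def by (rule INF_superset_mono) auto

text \<open>A finite union of closed balls is closed, so it contains \<open>E\<close> exactly when
  it contains the closure.\<close>

lemma free_covering_number_closure: "free_covering_number r (closure E) = free_covering_number r E"
proof -
  have "closure E \<subseteq> (\<Union>x\<in>C. cball x r) \<longleftrightarrow> E \<subseteq> (\<Union>x\<in>C. cball x r)" if "finite C" for C
    using that closure_subset[of E]
    by (metis closed_UN closed_cball closure_minimal order_trans)
  then show ?thesis unfolding free_covering_number_def by (metis (lifting))
qed

text \<open>Each interval of radius \<open>r\<close> is halved at its centre into two pieces of
  diameter \<open>r\<close>; the \<open>bool\<close> component selects the left or the right
  half.\<close>

lemma covering_number_le_free: "covering_number r E \<le> 2 * free_covering_number r E" for E :: "real set"
proof (cases "free_covering_number r E = top")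
  case False
  then obtain C where C: "finite C" "E \<subseteq> (\<Union>x\<in>C. cball x r)" "free_covering_number r E = of_nat (card C)"
    by (rule free_covering_number_attained)
  have "covering_number r E \<le> of_nat (card (C \<times> (UNIV :: bool set)))"
  proof (rule covering_number_le_card_pieces)
    show "E \<subseteq> (\<Union>i\<in>C \<times> UNIV. if snd i then {fst i - r..fst i} else {fst i..fst i + r})"
    proof
      fix x assume "x \<in> E"
      then obtain p where "p \<in> C" "\<bar>p - x\<bar> \<le> r" using C(2) by (auto simp: dist_real_def)
      then show "x \<in> (\<Union>i\<in>C \<times> UNIV. if snd i then {fst i - r..fst i} else {fst i..fst i + r})"
        by (intro UN_I[of "(p, x \<le> p)"]) (auto simp: abs_le_iff)
    qed
  qed (use C in \<open>auto simp: dist_real_def split: if_splits\<close>)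
  then show ?thesis by (simp add: C(3) card_cartesian_product mult.commute)
qed (simp add: ennreal_mult_top)

text \<open>On each side, the balls with centres too near or beyond the cut reach only points within
  2r of \<open>a\<close>, and one new ball centred at \<open>a - r\<close> or \<open>a + r\<close>
  replaces them. The balls kept on the two sides are distinct, so only 2 is added.\<close>

lemma free_covering_number_split:
  assumes "r > 0"
  shows "free_covering_number r (E \<inter> {..a}) + free_covering_number r (E - {..a})
    \<le> free_covering_number r E + 2"
proof (cases "free_covering_number r E = top")
  case False
  then obtain C where C: "finite C" "E \<subseteq> (\<Union>x\<in>C. cball x r)" "free_covering_number r E = of_nat (card C)"
    by (rule free_covering_number_attained)
  define L where "L = {x\<in>C. x \<le> a - r}"
  define R where "R = {x\<in>C. a + r < x}"
  have fin: "finite L" "finite R" using C(1) by (auto simp: L_def R_def)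
  have "E \<inter> {..a} \<subseteq> (\<Union>x\<in>insert (a - r) L. cball x r)"
  proof
    fix x assume x: "x \<in> E \<inter> {..a}"
    then obtain p where p: "p \<in> C" "\<bar>p - x\<bar> \<le> r" using C(2) by (auto simp: dist_real_def)
    show "x \<in> (\<Union>x\<in>insert (a - r) L. cball x r)"
    proof (cases "p \<le> a - r")
      case True
      then show ?thesis using p by (intro UN_I[of p]) (auto simp: L_def dist_real_def)
    next
      case False
      then have "\<bar>a - r - x\<bar> \<le> r" using x p(2) by auto
      then show ?thesis by (intro UN_I[of "a - r"]) (auto simp: dist_real_def)
    qed
  qed
  then have 1: "free_covering_number r (E \<inter> {..a}) \<le> of_nat (card (insert (a - r) L))"
    using fin by (intro free_covering_number_le) auto
  have "E - {..a} \<subseteq> (\<Union>x\<in>insert (a + r) R. cball x r)"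
  proof
    fix x assume x: "x \<in> E - {..a}"
    then obtain p where p: "p \<in> C" "\<bar>p - x\<bar> \<le> r" using C(2) by (auto simp: dist_real_def)
    show "x \<in> (\<Union>x\<in>insert (a + r) R. cball x r)"
    proof (cases "a + r < p")
      case True
      then show ?thesis using p by (intro UN_I[of p]) (auto simp: R_def dist_real_def)
    next
      case False
      then have "\<bar>a + r - x\<bar> \<le> r" using x p(2) by auto
      then show ?thesis by (intro UN_I[of "a + r"]) (auto simp: dist_real_def)
    qed
  qed
  then have 2: "free_covering_number r (E - {..a}) \<le> of_nat (card (insert (a + r) R))"
    using fin by (intro free_covering_number_le) auto
  have "card L + card R = card (L \<union> R)"
    using fin \<open>r > 0\<close> by (intro card_Un_disjoint[symmetric]) (auto simp: L_def R_def)
  also have "\<dots> \<le> card C" using C(1) by (intro card_mono) (auto simp: L_def R_def)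
  finally have "card (insert (a - r) L) + card (insert (a + r) R) \<le> card C + 2"
    using fin by (auto simp: card_insert_if)
  then have "of_nat (card (insert (a - r) L)) + of_nat (card (insert (a + r) R))
      \<le> (of_nat (card C) + 2 :: ennreal)"
    by (metis of_nat_add of_nat_mono of_nat_numeral)
  with add_mono[OF 1 2] show ?thesis unfolding C(3) by (rule order_trans)
qed simp

text \<open>The factor 2 makes this dominate the premeasure with centres in the set.\<close>

definition free_premeasure :: "real \<Rightarrow> real set \<Rightarrow> ennreal" where
  "free_premeasure s E =
     Liminf (at_right 0) (\<lambda>r. 2 * free_covering_number r E * ennreal ((2 * r) powr s))"

lemma free_premeasure_positive: "positive UNIV (free_premeasure s)"
proof -
  have "free_covering_number r {} = 0" for r
    using free_covering_number_le[of "{}" "{}" r] by simp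
  then show ?thesis by (simp add: positive_def free_premeasure_def Liminf_const)
qed

lemma free_premeasure_increasing: "increasing UNIV (free_premeasure s)"
  unfolding increasing_def free_premeasure_def
  by (auto intro!: Liminf_mono always_eventually mult_mono free_covering_number_mono)

text \<open>The two extra balls of \<open>free_covering_number_split\<close> weigh
  \<open>4 * (2 * r) powr s\<close>, counting the factor 2 of the premeasure, and this tends to 0
  because \<open>s\<close> is positive.\<close>

lemma free_premeasure_split:
  assumes "s > 0"
  shows "free_premeasure s (E \<inter> {..a}) + free_premeasure s (E - {..a}) \<le> free_premeasure s E"
proof -
  let ?g = "\<lambda>X r. 2 * free_covering_number r X * ennreal ((2 * r) powr s)"
  let ?e = "\<lambda>r::real. ennreal (4 * (2 * r) powr s)"
  have "((\<lambda>r::real. 4 * (2 * r) powr s) \<longlongrightarrow> 4 * (2 * 0) powr s) (at_right 0)"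
    using assms by (intro tendsto_powr' tendsto_intros)
      (auto simp: eventually_at_right_less eventually_at_filter)
  then have lim: "(?e \<longlongrightarrow> ennreal 0) (at_right 0)"
    using assms by (intro tendsto_ennrealI) simp
  have "free_premeasure s (E \<inter> {..a}) + free_premeasure s (E - {..a})
      \<le> Liminf (at_right 0) (\<lambda>r. ?g (E \<inter> {..a}) r + ?g (E - {..a}) r)"
    unfolding free_premeasure_def by (rule Liminf_add_le_ennreal) simp
  also have "\<dots> \<le> Liminf (at_right 0) (\<lambda>r. ?g E r + ?e r)"
  proof (rule Liminf_mono)
    show "\<forall>\<^sub>F r in at_right 0. ?g (E \<inter> {..a}) r + ?g (E - {..a}) r \<le> ?g E r + ?e r"
      using eventually_at_right_less[of 0]
    proof eventually_elim
      case (elim r)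
      have "?g (E \<inter> {..a}) r + ?g (E - {..a}) r
          = 2 * (free_covering_number r (E \<inter> {..a}) + free_covering_number r (E - {..a}))
            * ennreal ((2 * r) powr s)"
        by (simp add: algebra_simps)
      also have "\<dots> \<le> 2 * (free_covering_number r E + 2) * ennreal ((2 * r) powr s)"
        using free_covering_number_split[OF elim] by (intro mult_mono) auto
      also have "\<dots> = ?g E r + ?e r"
        by (simp add: algebra_simps ennreal_mult)
      finally show ?case .
    qed
  qed
  also have "\<dots> \<le> free_premeasure s E"
  \<comment> \<open>The error is eventually below any constant \<open>e\<close>, and a constant can
    be taken out of the lower limit.\<close>
  proof (rule ennreal_le_epsilon)
    fix e :: real assume "0 < e"
    then have "eventually (\<lambda>r. ?e r < ennreal e) (at_right 0)"
      using lim by (intro order_tendstoD(2)) auto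
    then have "Liminf (at_right 0) (\<lambda>r. ?g E r + ?e r) \<le> Liminf (at_right 0) (\<lambda>r. ?g E r + ennreal e)"
      by (intro Liminf_mono) (auto elim!: eventually_mono intro: add_mono)
    then show "Liminf (at_right 0) (\<lambda>r. ?g E r + ?e r) \<le> free_premeasure s E + ennreal e"
      by (simp add: Liminf_add_const free_premeasure_def)
  qed
  finally show ?thesis .
qed

section \<open>Comparison of the free outer measure with the Hewitt-Stromberg measure\<close>

lemma hs_measure_le_outer_measure: "hs_measure s E \<le> outer_measure UNIV (free_premeasure s) E"
  unfolding outer_measure_def
proof (safe intro!: INF_greatest)
  fix U :: "nat \<Rightarrow> real set" assume "E \<subseteq> (\<Union>i. U i)"
  then have "hs_measure s E \<le> (\<Sum>i. hs_premeasure s (U i))"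
    unfolding hs_measure_def by (intro INF_lower) auto
  also have "\<dots> \<le> (\<Sum>i. free_premeasure s (U i))"
    unfolding hs_premeasure_def hs_pre_at_def free_premeasure_def
    by (intro suminf_le Liminf_mono always_eventually allI mult_mono covering_number_le_free) auto
  finally show "hs_measure s E \<le> (\<Sum>i. free_premeasure s (U i))" .
qed

text \<open>This stands in for an increasing sets lemma: a bound on the free premeasure that is
  uniform along the sequence bounds the measure of the union.\<close>

lemma hs_measure_UN_incseq_le:
  assumes "s > 0" "incseq A"
  shows "hs_measure s (\<Union>n. A n) \<le> (SUP n. free_premeasure s (A n))"
proof -
  interpret ring_of_sets UNIV "UNIV :: real set set" using ring_of_sets_Pow[of UNIV] by simp
  let ?f = "free_premeasure s"
  have "hs_measure s (\<Union>n. A n) \<le> outer_measure UNIV ?f (\<Union>n. A n)"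
    by (rule hs_measure_le_outer_measure)
  also have "\<dots> \<le> (SUP n. outer_measure UNIV ?f (A n))"
    using assms free_premeasure_split
    by (intro outer_measure_UN_incseq free_premeasure_positive free_premeasure_increasing)
      (auto simp: free_premeasure_def free_covering_number_closure)
  also have "\<dots> \<le> (SUP n. ?f (A n))"
  proof (rule SUP_mono)
    fix n
    have "outer_measure UNIV ?f (A n) \<le> (\<Sum>i. ?f (if i = (0::nat) then A n else {}))"
      by (rule outer_measure_le[OF free_premeasure_positive free_premeasure_increasing]) auto
    also have "\<dots> = ?f (A n)"
      using free_premeasure_positive[of s]
      by (subst suminf_finite[of "{0}"]) (auto simp: positive_def)
    finally show "\<exists>m\<in>UNIV. outer_measure UNIV ?f (A n) \<le> ?f (A m)" by blast
  qed
  finally show ?thesis .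
qed

section \<open>Counting along vertical sections\<close>

lemma hs_measure_le_hs_premeasure: "hs_measure t E \<le> hs_premeasure t E"
proof -
  have "hs_measure t E \<le> (\<Sum>i. hs_premeasure t (if i = (0::nat) then E else {}))"
    unfolding hs_measure_def by (rule INF_lower) auto
  also have "\<dots> = hs_premeasure t E"
    by (subst suminf_finite[of "{0}"]) (auto simp: hs_premeasure_empty)
  finally show ?thesis .
qed

text \<open>A ball meeting the vertical line at \<open>x\<close> has its centre within
  \<open>r\<close> of that line. On the line only ordinates vary, so the ball's trace is covered by
  two segments of length \<open>r\<close>, above and below the ordinate of the centre.\<close>

lemma covering_number_vsection_le:
  assumes "finite C" and "F \<subseteq> (\<Union>p\<in>C. cball p r)"
  shows "covering_number r (vsection F x) \<le> 2 * of_nat (card {p\<in>C. \<bar>fst p - x\<bar> \<le> r})"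
proof -
  define D where "D = {p\<in>C. \<bar>fst p - x\<bar> \<le> r}"
  define S :: "(real \<times> real) \<times> bool \<Rightarrow> (real \<times> real) set" where
    "S i = {q. if snd i then snd q \<in> {snd (fst i) - r..snd (fst i)}
                else snd q \<in> {snd (fst i)..snd (fst i) + r}}" for i
  have "covering_number r (vsection F x) \<le> of_nat (card (D \<times> (UNIV :: bool set)))"
  proof (rule covering_number_le_card_pieces)
    show "finite (D \<times> (UNIV :: bool set))" using assms(1) by (simp add: D_def)
    show "vsection F x \<subseteq> (\<Union>i\<in>D \<times> UNIV. S i)"
    proof
      fix q assume q: "q \<in> vsection F x"
      then obtain p where p: "p \<in> C" "dist p q \<le> r" using assms(2) by (auto simp: vsection_def)
      have "\<bar>fst p - x\<bar> \<le> r" "\<bar>snd p - snd q\<bar> \<le> r"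
        using dist_fst_le[of p q] dist_snd_le[of p q] p(2) q by (auto simp: vsection_def dist_real_def)
      then show "q \<in> (\<Union>i\<in>D \<times> UNIV. S i)"
        using p(1) by (intro UN_I[of "(p, snd q \<le> snd p)"]) (auto simp: D_def S_def)
    qed
    fix i y z assume "y \<in> vsection F x \<inter> S i" "z \<in> vsection F x \<inter> S i"
    then show "dist y z \<le> r"
      by (cases y; cases z)
        (auto simp: vsection_def S_def dist_Pair_Pair dist_real_def split: if_splits)
  qed
  then show ?thesis by (simp add: D_def card_cartesian_product mult.commute)
qed

text \<open>No ball of radius \<open>r\<close> can meet the sections at two abscissas more than 2r
  apart, so the local counts add up to at most one optimal cover of \<open>F\<close>. The weight
  \<open>w\<close> is left free to serve both for \<open>(2 * r) powr t\<close> and for 1.\<close>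

lemma card_separated_le_covering_number:
  assumes "finite X" and sep: "pairwise (\<lambda>x y. 2 * r < dist x y) X"
    and "0 < w" and c: "\<And>x. x \<in> X \<Longrightarrow> c \<le> covering_number r (vsection F x) * w"
  shows "of_nat (card X) * c \<le> 2 * (covering_number r F * w)"
proof (cases "covering_number r F = top")
  case True
  then show ?thesis using \<open>0 < w\<close> by (simp add: ennreal_top_mult ennreal_mult_top)
next
  case False
  then obtain C where "C \<in> {C. finite C \<and> C \<subseteq> F \<and> F \<subseteq> (\<Union>x\<in>C. cball x r)}"
      and cov: "covering_number r F = of_nat (card C)"
    unfolding covering_number_def by (rule INF_of_nat_attained)
  then have C: "finite C" "F \<subseteq> (\<Union>x\<in>C. cball x r)" by auto
  define D where "D x = {p\<in>C. \<bar>fst p - x\<bar> \<le> r}" for x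
  have disj: "D x \<inter> D y = {}" if "x \<in> X" "y \<in> X" "x \<noteq> y" for x y
  proof (rule ccontr)
    assume "D x \<inter> D y \<noteq> {}"
    then obtain p where "\<bar>fst p - x\<bar> \<le> r" "\<bar>fst p - y\<bar> \<le> r" by (auto simp: D_def)
    then have "dist x y \<le> 2 * r" by (simp add: dist_real_def)
    with pairwiseD[OF sep that] show False by simp
  qed
  have "of_nat (card X) * c = (\<Sum>x\<in>X. c)" by simp
  also have "\<dots> \<le> (\<Sum>x\<in>X. 2 * of_nat (card (D x)) * w)"
  proof (rule sum_mono)
    fix x assume "x \<in> X"
    then have "c \<le> covering_number r (vsection F x) * w" by (rule c)
    also have "\<dots> \<le> 2 * of_nat (card (D x)) * w"
      using covering_number_vsection_le[OF C, of x] by (intro mult_mono) (auto simp: D_def)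
    finally show "c \<le> 2 * of_nat (card (D x)) * w" .
  qed
  also have "\<dots> = 2 * of_nat (\<Sum>x\<in>X. card (D x)) * w"
    by (simp add: sum_distrib_left sum_distrib_right)
  also have "(\<Sum>x\<in>X. card (D x)) = card (\<Union>x\<in>X. D x)"
    using assms(1) C(1) disj by (intro card_UN_disjoint[symmetric]) (auto simp: D_def)
  also have "2 * of_nat (card (\<Union>x\<in>X. D x)) * w \<le> 2 * of_nat (card C) * w"
    using C(1) by (intro mult_mono of_nat_mono card_mono) (auto simp: D_def)
  finally show ?thesis by (simp add: cov mult.assoc)
qed

text \<open>The bound \<open>k\<close> yields a separated set of greatest cardinality; a point
  farther than \<open>d\<close> from all of it could be adjoined.\<close>

lemma maximal_separated_subset:
  fixes A :: "'a::metric_space set"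
  assumes bound: "\<And>X. finite X \<Longrightarrow> X \<subseteq> A \<Longrightarrow> pairwise (\<lambda>x y. d < dist x y) X \<Longrightarrow> card X \<le> k"
  obtains X where "finite X" "X \<subseteq> A" "pairwise (\<lambda>x y. d < dist x y) X"
    "\<forall>a\<in>A - X. \<exists>x\<in>X. dist x a \<le> d"
proof -
  let ?P = "\<lambda>X. finite X \<and> X \<subseteq> A \<and> pairwise (\<lambda>x y. d < dist x y) X"
  have "?P {}" by simp
  moreover have "\<forall>X. ?P X \<longrightarrow> card X < Suc k" using bound by (simp add: le_imp_less_Suc)
  ultimately have "\<exists>X. ?P X \<and> (\<forall>Y. ?P Y \<longrightarrow> card Y \<le> card X)"
    by (rule ex_has_greatest_nat)
  then obtain X where *: "?P X \<and> (\<forall>Y. ?P Y \<longrightarrow> card Y \<le> card X)" by (rule exE)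
  note X = conjunct1[OF *] and max = conjunct2[OF *]
  have "\<exists>x\<in>X. dist x a \<le> d" if a: "a \<in> A - X" for a
  proof (rule ccontr)
    assume "\<not> (\<exists>x\<in>X. dist x a \<le> d)"
    then have "?P (insert a X)" using X a by (auto simp: not_le dist_commute pairwise_insert)
    then have "card (insert a X) \<le> card X" using max by blast
    then show False using X a by simp
  qed
  with X show ?thesis by (intro that[of X]) auto
qed

text \<open>The constant 8 is a product of three factors 2: one built into
  \<open>free_premeasure\<close>, one for the two intervals covering a neighbourhood of each
  separated point, one for halving balls in \<open>covering_number_vsection_le\<close>.\<close>

lemma free_covering_number_le_hs_pre_at:
  assumes "r > 0" and ne: "\<And>x. x \<in> A \<Longrightarrow> vsection F x \<noteq> {}"
    and c: "\<And>x. x \<in> A \<Longrightarrow> c \<le> hs_pre_at t r (vsection F x)"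
  shows "c * (2 * free_covering_number r A * ennreal ((2 * r) powr s)) \<le> 8 * hs_pre_at (s + t) r F"
proof (cases "covering_number r F = top")
  case True
  then show ?thesis using \<open>r > 0\<close> by (simp add: hs_pre_at_def ennreal_top_mult ennreal_mult_top)
next
  case False
  then obtain k where k: "covering_number r F = of_nat k"
    unfolding covering_number_def by (rule INF_of_nat_attained)
  \<comment> \<open>Nonempty sections need at least one ball each; counting with weight 1 bounds
    every separated set, so a maximal one exists.\<close>
  have "card X \<le> 2 * k" if "finite X" "X \<subseteq> A" "pairwise (\<lambda>x y. 2 * r < dist x y) X" for X
  proof -
    have "of_nat (card X) * 1 \<le> 2 * (covering_number r F * 1)"
      using that covering_number_ge_1[OF ne] by (intro card_separated_le_covering_number) auto
    then have "(of_nat (card X) :: ennreal) \<le> of_nat (2 * k)" by (simp add: k)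
    then show ?thesis by (simp only: of_nat_le_iff)
  qed
  then obtain X where X: "finite X" "X \<subseteq> A" "pairwise (\<lambda>x y. 2 * r < dist x y) X"
    "\<forall>a\<in>A - X. \<exists>x\<in>X. dist x a \<le> 2 * r"
    by (rule maximal_separated_subset)
  \<comment> \<open>By maximality every point of \<open>A\<close> is within 2r of some
    \<open>x\<close> in \<open>X\<close>, and the balls about \<open>x - r\<close> and
    \<open>x + r\<close> together fill that neighbourhood.\<close>
  let ?C = "(\<lambda>x. x - r) ` X \<union> (\<lambda>x. x + r) ` X"
  have "A \<subseteq> (\<Union>x\<in>?C. cball x r)"
  proof
    fix a assume "a \<in> A"
    then obtain x where x: "x \<in> X" "\<bar>x - a\<bar> \<le> 2 * r"
      using X(4) \<open>r > 0\<close> by (cases "a \<in> X") (auto simp: dist_real_def)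
    show "a \<in> (\<Union>x\<in>?C. cball x r)"
    proof (cases "a \<le> x")
      case True
      with x have "\<bar>x - r - a\<bar> \<le> r" by auto
      then show ?thesis using x(1) by (intro UN_I[of "x - r"]) (auto simp: dist_real_def)
    next
      case False
      with x have "\<bar>x + r - a\<bar> \<le> r" by auto
      then show ?thesis using x(1) by (intro UN_I[of "x + r"]) (auto simp: dist_real_def)
    qed
  qed
  then have "free_covering_number r A \<le> of_nat (card ?C)"
    using X(1) by (intro free_covering_number_le) auto
  also have "card ?C \<le> 2 * card X"
    using card_Un_le[of "(\<lambda>x. x - r) ` X" "(\<lambda>x. x + r) ` X"]
      card_image_le[OF X(1), of "\<lambda>x. x - r"] card_image_le[OF X(1), of "\<lambda>x. x + r"] by linarith
  then have "of_nat (card ?C) \<le> (of_nat (2 * card X) :: ennreal)" by (rule of_nat_mono)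
  finally have M: "free_covering_number r A \<le> 2 * of_nat (card X)" by simp
  let ?v = "ennreal ((2 * r) powr s)" and ?w = "ennreal ((2 * r) powr t)"
  have N: "of_nat (card X) * c \<le> 2 * (covering_number r F * ?w)"
    using X c \<open>r > 0\<close> by (intro card_separated_le_covering_number) (auto simp: hs_pre_at_def)
  have "c * (2 * free_covering_number r A * ?v) \<le> c * (2 * (2 * of_nat (card X)) * ?v)"
    using M by (intro mult_mono) auto
  also have "\<dots> = 4 * (of_nat (card X) * c) * ?v" by (simp add: ac_simps)
  also have "\<dots> \<le> 4 * (2 * (covering_number r F * ?w)) * ?v"
    by (intro mult_left_mono mult_right_mono N) auto
  also have "\<dots> = 8 * (covering_number r F * (?v * ?w))" by (simp add: ac_simps)
  also have "?v * ?w = ennreal ((2 * r) powr (s + t))"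
    by (simp add: powr_add ennreal_mult)
  finally show ?thesis by (simp add: hs_pre_at_def)
qed

text \<open>Finitely many abscissas are 2r-separated, and all their sections satisfy the lower
  bound, as soon as \<open>r\<close> is small; the separated count then applies to all of
  \<open>X\<close>.\<close>

lemma card_le_hs_premeasure:
  assumes "finite X" and c: "\<And>x. x \<in> X \<Longrightarrow> c < hs_premeasure t (vsection F x)"
  shows "of_nat (card X) * c \<le> 2 * hs_premeasure t F"
proof -
  have "eventually (\<lambda>r::real. 2 * r < dist x y) (at_right 0)" if "x \<noteq> y" for x y :: real
    unfolding eventually_at_right_field
    using that by (intro exI[of _ "dist x y / 2"]) auto
  then have "eventually (\<lambda>r. \<forall>x\<in>X. \<forall>y\<in>X. x \<noteq> y \<longrightarrow> 2 * r < dist x y) (at_right 0)"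
    using assms(1) by (intro eventually_ball_finite ballI) (auto simp: eventually_conj_iff)
  moreover have "eventually (\<lambda>r. \<forall>x\<in>X. c < hs_pre_at t r (vsection F x)) (at_right 0)"
    using assms(1) c by (intro eventually_ball_finite ballI less_LiminfD) (auto simp: hs_premeasure_def)
  ultimately have "eventually (\<lambda>r. of_nat (card X) * c \<le> 2 * hs_pre_at t r F) (at_right 0)"
    using eventually_at_right_less[of 0]
  proof eventually_elim
    case (elim r)
    then show ?case
      unfolding hs_pre_at_def using assms(1)
      by (intro card_separated_le_covering_number) (auto intro: less_imp_le simp: pairwise_def)
  qed
  then have "of_nat (card X) * c \<le> Liminf (at_right 0) (\<lambda>r. 2 * hs_pre_at t r F)"
    by (rule Liminf_bounded)
  then show ?thesis by (simp add: Liminf_cmult_ennreal hs_premeasure_def)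
qed

section \<open>The exponent zero\<close>

lemma hs_measure_0_le_card:
  assumes "finite E"
  shows "hs_measure 0 E \<le> of_nat (card E)"
proof -
  have "eventually (\<lambda>r. hs_pre_at 0 r E \<le> of_nat (card E)) (at_right 0)"
    using eventually_at_right_less[of 0]
  proof eventually_elim
    case (elim r)
    then have "covering_number r E \<le> of_nat (card E)"
      unfolding covering_number_def using assms by (intro INF_lower) auto
    \<comment> \<open>Positivity of \<open>r\<close> matters: \<open>0 powr 0\<close> is 0, whereas
      here the weight must be 1.\<close>
    with elim show ?case by (simp add: hs_pre_at_def)
  qed
  then have "hs_premeasure 0 E \<le> of_nat (card E)"
    unfolding hs_premeasure_def by (intro Liminf_le) auto
  with hs_measure_le_hs_premeasure show ?thesis by (rule order_trans)
qed

text \<open>At \<open>s = 0\<close> the cutting error does not vanish, so the argument through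
  measurability is replaced by counting points of \<open>A\<close>.\<close>

lemma hs_measure_0_le_hs_premeasure:
  assumes c: "\<And>x. x \<in> A \<Longrightarrow> c < hs_premeasure t (vsection F x)"
  shows "c * hs_measure 0 A \<le> 2 * hs_premeasure t F"
proof (cases "finite A")
  case True
  have "c * hs_measure 0 A \<le> of_nat (card A) * c"
    using hs_measure_0_le_card[OF True] by (subst mult.commute) (intro mult_mono, auto)
  with card_le_hs_premeasure[OF True c] show ?thesis by (rule order_trans[rotated])
next
  case False
  \<comment> \<open>For infinite \<open>A\<close> the measure is bounded by \<open>top\<close>, the
    supremum of the cardinalities of finite subsets.\<close>
  have "c * hs_measure 0 A \<le> (SUP k. of_nat k) * c"
    by (subst mult.commute) (intro mult_mono, auto simp: ennreal_SUP_of_nat_eq_top)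
  also have "\<dots> = (SUP k. of_nat k * c)" by (rule SUP_mult_right_ennreal)
  also have "\<dots> \<le> 2 * hs_premeasure t F"
  proof (rule SUP_least)
    fix k :: nat
    obtain X where "X \<subseteq> A" "finite X" "card X = k"
      using infinite_arbitrarily_large[OF False] by blast
    then show "of_nat k * c \<le> 2 * hs_premeasure t F"
      using card_le_hs_premeasure[of X c t F] c by blast
  qed
  finally show ?thesis .
qed

text \<open>The premeasure of \<open>F\<close> stands on the right because the counting compares
  \<open>F\<close> with \<open>A\<close> at one scale at a time; regularity later converts it into
  the measure.\<close>

theorem hs_measure_le_hs_premeasure_sections:
  assumes "s \<ge> 0" and c: "\<And>x. x \<in> A \<Longrightarrow> c < hs_premeasure t (vsection F x)"
  shows "c * hs_measure s A \<le> 8 * hs_premeasure (s + t) F"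
proof (cases "s = 0 \<or> A = {}")
  case True
  then consider "s = 0" | "A = {}" by blast
  then show ?thesis
  proof cases
    case 1
    have "c * hs_measure 0 A \<le> 2 * hs_premeasure t F"
      using c by (rule hs_measure_0_le_hs_premeasure)
    also have "\<dots> \<le> 8 * hs_premeasure t F" by (intro mult_mono) auto
    finally show ?thesis by (simp add: 1)
  next
    case 2
    have "hs_measure s ({} :: real set) = 0"
      using hs_measure_le_hs_premeasure[of s "{} :: real set"] by (simp add: hs_premeasure_empty)
    then show ?thesis by (simp add: 2)
  qed
next
  case False
  then have "s > 0" using \<open>s \<ge> 0\<close> by simp
  \<comment> \<open>A point of \<open>A\<close> and the strict inequality there force
    \<open>c\<close> to be finite, as is needed to take it out of a lower limit.\<close>
  have "c < top" using False c by (meson ex_in_conv less_top_ennreal order.strict_trans2 top_greatest)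
  \<comment> \<open>The scale from which the lower bound holds depends on \<open>x\<close>;
    \<open>A' n\<close> collects the points for which \<open>1 / Suc n\<close> suffices.\<close>
  define A' where "A' n = {x\<in>A. \<forall>r. 0 < r \<longrightarrow> r < 1 / Suc n \<longrightarrow> c \<le> hs_pre_at t r (vsection F x)}" for n
  have inc: "incseq A'"
  proof (rule incseq_SucI)
    fix n
    have "1 / real (Suc (Suc n)) \<le> 1 / real (Suc n)" by (simp add: frac_le)
    then show "A' n \<subseteq> A' (Suc n)" unfolding A'_def using less_le_trans by blast
  qed
  have UN: "(\<Union>n. A' n) = A"
  proof (intro antisym subsetI)
    fix x assume x: "x \<in> A"
    have "eventually (\<lambda>r. c < hs_pre_at t r (vsection F x)) (at_right 0)"
      using c[OF x] unfolding hs_premeasure_def by (rule less_LiminfD)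
    then obtain b :: real where b: "0 < b" "\<And>r. 0 < r \<Longrightarrow> r < b \<Longrightarrow> c < hs_pre_at t r (vsection F x)"
      unfolding eventually_at_right_field by auto
    obtain n where "1 / real (Suc n) < b" using nat_approx_posE[OF b(1)] by auto
    then have "x \<in> A' n" using x b(2) by (auto simp: A'_def intro!: less_imp_le)
    then show "x \<in> (\<Union>n. A' n)" by blast
  qed (auto simp: A'_def)
  have ne: "vsection F x \<noteq> {}" if "x \<in> A" for x
    using c[OF that] by (auto simp: hs_premeasure_empty)
  have bound: "c * free_premeasure s (A' n) \<le> 8 * hs_premeasure (s + t) F" for n
  proof -
    have "c * free_premeasure s (A' n)
        = Liminf (at_right 0) (\<lambda>r. c * (2 * free_covering_number r (A' n) * ennreal ((2 * r) powr s)))"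
      unfolding free_premeasure_def using \<open>c < top\<close> by (intro Liminf_cmult_ennreal[symmetric]) auto
    also have "\<dots> \<le> Liminf (at_right 0) (\<lambda>r. 8 * hs_pre_at (s + t) r F)"
    proof (rule Liminf_mono)
      show "\<forall>\<^sub>F r in at_right 0. c * (2 * free_covering_number r (A' n) * ennreal ((2 * r) powr s))
          \<le> 8 * hs_pre_at (s + t) r F"
        unfolding eventually_at_right_field
        using ne by (intro exI[of _ "1 / real (Suc n)"] conjI allI impI free_covering_number_le_hs_pre_at)
          (auto simp: A'_def)
    qed
    also have "\<dots> = 8 * hs_premeasure (s + t) F"
      unfolding hs_premeasure_def by (intro Liminf_cmult_ennreal) auto
    finally show ?thesis .
  qed
  have "c * hs_measure s A \<le> c * (SUP n. free_premeasure s (A' n))"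
    using hs_measure_UN_incseq_le[OF \<open>s > 0\<close> inc] by (intro mult_left_mono) (auto simp: UN)
  also have "\<dots> = (SUP n. c * free_premeasure s (A' n))" by (rule SUP_mult_left_ennreal)
  also have "\<dots> \<le> 8 * hs_premeasure (s + t) F" by (intro SUP_least bound)
  finally show ?thesis .
qed

section \<open>Cartesian products\<close>

text \<open>Projection to the second coordinate shrinks distances and sends centres in the section
  to centres in \<open>B\<close>.\<close>

lemma hs_premeasure_le_vsection_Times:
  fixes A B :: "real set"
  assumes "x \<in> A"
  shows "hs_premeasure t B \<le> hs_premeasure t (vsection (A \<times> B) x)"
proof -
  have "covering_number r B \<le> covering_number r (vsection (A \<times> B) x)" for r
    unfolding covering_number_def[of r "vsection (A \<times> B) x"]
  proof (rule INF_greatest)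
    fix C assume "C \<in> {C. finite C \<and> C \<subseteq> vsection (A \<times> B) x \<and> vsection (A \<times> B) x \<subseteq> (\<Union>p\<in>C. cball p r)}"
    then have C: "finite C" "C \<subseteq> vsection (A \<times> B) x" "vsection (A \<times> B) x \<subseteq> (\<Union>p\<in>C. cball p r)"
      by auto
    have "B \<subseteq> (\<Union>y\<in>snd ` C. cball y r)"
    proof
      fix y assume "y \<in> B"
      then have "(x, y) \<in> vsection (A \<times> B) x" using assms by (simp add: vsection_def)
      then obtain p where "p \<in> C" "dist p (x, y) \<le> r" using C(3) by auto
      then show "y \<in> (\<Union>y\<in>snd ` C. cball y r)" using dist_snd_le[of p "(x, y)"] by force
    qed
    then have "covering_number r B \<le> of_nat (card (snd ` C))"
      unfolding covering_number_def using C(1,2) by (intro INF_lower) (auto simp: vsection_def)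
    also have "\<dots> \<le> of_nat (card C)" using C(1) by (intro of_nat_mono card_image_le)
    finally show "covering_number r B \<le> of_nat (card C)" .
  qed
  then show ?thesis
    unfolding hs_premeasure_def hs_pre_at_def by (intro Liminf_mono always_eventually allI mult_mono) auto
qed

lemma hs_measure_mult_le_hs_premeasure_Times:
  fixes A B :: "real set"
  assumes "s \<ge> 0"
  shows "hs_measure t B * hs_measure s A \<le> 8 * hs_premeasure (s + t) (A \<times> B)"
proof -
  \<comment> \<open>The section bound needs a strict inequality, so the measure of \<open>B\<close>
    is approached from below; this also covers an infinite value.\<close>
  have "hs_measure t B * hs_measure s A = (SUP c\<in>{..<hs_measure t B}. c) * hs_measure s A"
    by (simp add: Sup_lessThan)
  also have "\<dots> = (SUP c\<in>{..<hs_measure t B}. c * hs_measure s A)" by (rule SUP_mult_right_ennreal)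
  also have "\<dots> \<le> 8 * hs_premeasure (s + t) (A \<times> B)"
  proof (rule SUP_least)
    fix c assume "c \<in> {..<hs_measure t B}"
    then have "c < hs_premeasure t B"
      using hs_measure_le_hs_premeasure[of t B] by auto
    then have "c < hs_premeasure t (vsection (A \<times> B) x)" if "x \<in> A" for x
      using hs_premeasure_le_vsection_Times[OF that] by (rule less_le_trans)
    then show "c * hs_measure s A \<le> 8 * hs_premeasure (s + t) (A \<times> B)"
      by (rule hs_measure_le_hs_premeasure_sections[OF assms])
  qed
  finally show ?thesis .
qed

section \<open>Dimensions of products\<close>

lemma hs_measure_0_ge_1:
  assumes "E \<noteq> {}"
  shows "1 \<le> hs_measure 0 E"
  unfolding hs_measure_def
proof (safe intro!: INF_greatest)
  fix U :: "nat \<Rightarrow> 'a set" assume "E \<subseteq> (\<Union>i. U i)"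
  \<comment> \<open>A nonempty member of the cover needs at least one ball at every scale, and at
    exponent 0 that ball has weight 1.\<close>
  then obtain i where i: "U i \<noteq> {}" using assms by blast
  have "1 \<le> hs_premeasure 0 (U i)"
    unfolding hs_premeasure_def
  proof (rule Liminf_bounded)
    show "\<forall>\<^sub>F r in at_right 0. 1 \<le> hs_pre_at 0 r (U i)"
      using eventually_at_right_less[of 0] covering_number_ge_1[OF i]
      by (auto elim!: eventually_mono simp: hs_pre_at_def)
  qed
  also have "\<dots> \<le> (\<Sum>i. hs_premeasure 0 (U i))"
    using sum_le_suminf[of "\<lambda>i. hs_premeasure 0 (U i)" "{i}"] by simp
  finally show "1 \<le> (\<Sum>i. hs_premeasure 0 (U i))" .
qed

text \<open>Exponents of infinite measure add up, so their suprema do. If one factor has no such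
  exponent, exponent 0 is used for it: its measure there is nonzero, which avoids the product of 0
  and infinity.\<close>

lemma hs_dim_add_le:
  assumes top: "\<And>s t. s \<ge> 0 \<Longrightarrow> t \<ge> 0 \<Longrightarrow> hs_measure s A * hs_measure t B = top
      \<Longrightarrow> hs_measure (s + t) E = top"
    and "A \<noteq> {}" "B \<noteq> {}"
  shows "hs_dim A + hs_dim B \<le> hs_dim E"
proof -
  let ?S = "\<lambda>A. {t. 0 \<le> t \<and> hs_measure t A = \<infinity>}"
  have dim: "hs_dim X = (SUP t\<in>?S X. ennreal t)" for X :: "'x::euclidean_space set"
    unfolding hs_dim_def by (rule arg_cong[where f = Sup]) auto
  have E: "ennreal (s + t) \<le> hs_dim E" if "hs_measure (s + t) E = top" "s \<ge> 0" "t \<ge> 0" for s t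
    unfolding dim using that by (intro SUP_upper) auto
  have A0: "hs_measure 0 A \<noteq> 0" and B0: "hs_measure 0 B \<noteq> 0"
    using hs_measure_0_ge_1[OF \<open>A \<noteq> {}\<close>] hs_measure_0_ge_1[OF \<open>B \<noteq> {}\<close>] by auto
  consider "?S A = {}" | "?S B = {}" | "?S A \<noteq> {}" "?S B \<noteq> {}" by blast
  then show ?thesis
  proof cases
    case 1
    have "ennreal t \<le> hs_dim E" if "t \<in> ?S B" for t
      using that E[of 0 t] top[of 0 t] A0 by (auto simp: ennreal_mult_top)
    then have "hs_dim B \<le> hs_dim E" unfolding dim[of B] by (rule SUP_least)
    moreover have "hs_dim A = 0" unfolding dim[of A] 1 by (simp add: bot_ennreal)
    ultimately show ?thesis by simp
  next
    case 2
    have "ennreal s \<le> hs_dim E" if "s \<in> ?S A" for s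
      using that E[of s 0] top[of s 0] B0 by (auto simp: ennreal_top_mult)
    then have "hs_dim A \<le> hs_dim E" unfolding dim[of A] by (rule SUP_least)
    moreover have "hs_dim B = 0" unfolding dim[of B] 2 by (simp add: bot_ennreal)
    ultimately show ?thesis by simp
  next
    case 3
    have "ennreal s + ennreal t \<le> hs_dim E" if "s \<in> ?S A" "t \<in> ?S B" for s t
      using that E[of s t] top[of s t] by (auto simp: ennreal_mult_top)
    then have "(SUP t\<in>?S B. SUP s\<in>?S A. ennreal s + ennreal t) \<le> hs_dim E"
      by (intro SUP_least)
    then show ?thesis
      unfolding dim[of A] dim[of B]
      by (simp only: ennreal_SUP_add_left[OF 3(1)] ennreal_SUP_add_right[OF 3(2)])
  qed
qed

text \<open>Regularity turns the premeasure into \<open>\<xi>\<close> times the measure;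
  \<open>\<xi>\<close> cancels, leaving 8/12 = 2/3, which is below 1.\<close>

lemma xi_regular_scale:
  assumes "\<xi> > 0" "xi_regular \<xi> F" "u \<ge> 0" "K \<le> 8 * hs_premeasure u F"
  shows "ennreal (1 / 12 * inverse \<xi>) * K \<le> hs_measure u F"
proof -
  have "ennreal (1 / 12 * inverse \<xi>) * K
      \<le> ennreal (1 / 12 * inverse \<xi>) * (8 * (ennreal \<xi> * hs_measure u F))"
    using assms by (intro mult_left_mono) (auto simp: xi_regular_def)
  also have "\<dots> = ennreal (1 / 12 * inverse \<xi>) * (ennreal 8 * ennreal \<xi>) * hs_measure u F"
    by (simp add: mult.assoc)
  also have "ennreal (1 / 12 * inverse \<xi>) * (ennreal 8 * ennreal \<xi>) = ennreal (2 / 3)"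
    using assms(1) by (simp add: ennreal_mult[symmetric] del: ennreal_numeral)
  also have "ennreal (2 / 3) * hs_measure u F \<le> 1 * hs_measure u F"
    by (intro mult_right_mono) (auto simp: ennreal_le_1)
  finally show ?thesis by simp
qed

text \<open>The first part is stated in \<open>ereal\<close> so that \<open>c\<close> may be
  negative. Nonempty factors are required for the dimensions: an empty factor makes the product
  empty, of dimension 0 under the supremum convention, whatever the other factor.\<close>

theorem corollary3:
  fixes b\<^sub>1 \<alpha>\<^sub>1 \<gamma> \<xi> :: real
  assumes "b\<^sub>1 = 2" and "\<alpha>\<^sub>1 = 3" and "\<gamma> = inverse (b\<^sub>1\<^sup>2) * inverse \<alpha>\<^sub>1" and "\<xi> > 0"
  shows
    "(\<forall>(F :: (real \<times> real) set) (A :: real set) (s :: real) (t :: real) (c :: real).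
        s \<ge> 0 \<longrightarrow> t \<ge> 0 \<longrightarrow>
        (\<forall>x\<in>A. enn2ereal (hs_measure t (vsection F x)) > ereal c) \<longrightarrow>
        xi_regular \<xi> F \<longrightarrow>
        enn2ereal (hs_measure (s + t) F)
          \<ge> ereal (\<gamma> * inverse \<xi> * c) * enn2ereal (hs_measure s A))
     \<and>
     (\<forall>(A :: real set) (B :: real set).
        xi_regular \<xi> (A \<times> B) \<longrightarrow>
        (\<forall>(s :: real) (t :: real). s \<ge> 0 \<longrightarrow> t \<ge> 0 \<longrightarrow>
           hs_measure (s + t) (A \<times> B)
             \<ge> ennreal (\<gamma> * inverse \<xi>) * hs_measure s A * hs_measure t B)
        \<and> (A \<noteq> {} \<longrightarrow> B \<noteq> {} \<longrightarrow> hs_dim (A \<times> B) \<ge> hs_dim A + hs_dim B))"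
proof -
  have \<gamma>: "\<gamma> = 1 / 12" using assms(1-3) by simp
  have a: "enn2ereal (hs_measure (s + t) F) \<ge> ereal (\<gamma> * inverse \<xi> * c) * enn2ereal (hs_measure s A)"
    if st: "s \<ge> 0" "t \<ge> 0" and c: "\<And>x. x \<in> A \<Longrightarrow> enn2ereal (hs_measure t (vsection F x)) > ereal c"
      and F: "xi_regular \<xi> F"
    for F :: "(real \<times> real) set" and A :: "real set" and s t c :: real
  proof (cases "c \<ge> 0")
    case True
    have "ennreal c < hs_premeasure t (vsection F x)" if "x \<in> A" for x
    proof -
      have "ennreal c < hs_measure t (vsection F x)"
        using c[OF that] True by (simp add: less_ennreal.rep_eq enn2ereal_ennreal)
      then show ?thesis using hs_measure_le_hs_premeasure by (rule less_le_trans)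
    qed
    then have "ennreal c * hs_measure s A \<le> 8 * hs_premeasure (s + t) F"
      by (rule hs_measure_le_hs_premeasure_sections[OF st(1)])
    then have "ennreal (\<gamma> * inverse \<xi>) * (ennreal c * hs_measure s A) \<le> hs_measure (s + t) F"
      unfolding \<gamma> using st F assms(4) by (intro xi_regular_scale) auto
    moreover have "ennreal (\<gamma> * inverse \<xi> * c) = ennreal (\<gamma> * inverse \<xi>) * ennreal c"
      using True assms(4) by (intro ennreal_mult) (auto simp: \<gamma>)
    ultimately have "ennreal (\<gamma> * inverse \<xi> * c) * hs_measure s A \<le> hs_measure (s + t) F"
      by (simp only: mult.assoc)
    then show ?thesis
      using True assms(4) by (simp add: \<gamma> less_eq_ennreal.rep_eq times_ennreal.rep_eq enn2ereal_ennreal)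
  next
    case False
    \<comment> \<open>For negative \<open>c\<close> the left-hand side is at most 0, even if the
      measure of \<open>A\<close> is infinite.\<close>
    then have "ereal (\<gamma> * inverse \<xi> * c) \<le> 0"
      using assms(4) by (simp add: \<gamma> mult_nonneg_nonpos)
    then have "ereal (\<gamma> * inverse \<xi> * c) * enn2ereal (hs_measure s A) \<le> 0"
      by (simp add: ereal_mult_le_0_iff)
    also have "0 \<le> enn2ereal (hs_measure (s + t) F)" by simp
    finally show ?thesis .
  qed
  have b: "hs_measure (s + t) (A \<times> B) \<ge> ennreal (\<gamma> * inverse \<xi>) * hs_measure s A * hs_measure t B"
    if "xi_regular \<xi> (A \<times> B)" "s \<ge> 0" "t \<ge> 0" for A B :: "real set" and s t
  proof -
    have "ennreal (\<gamma> * inverse \<xi>) * (hs_measure t B * hs_measure s A) \<le> hs_measure (s + t) (A \<times> B)"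
      unfolding \<gamma> using that assms(4)
      by (intro xi_regular_scale hs_measure_mult_le_hs_premeasure_Times) auto
    then show ?thesis by (simp only: mult.assoc mult.commute[of "hs_measure t B"])
  qed
  have dim: "hs_dim A + hs_dim B \<le> hs_dim (A \<times> B)"
    if reg: "xi_regular \<xi> (A \<times> B)" and "A \<noteq> {}" "B \<noteq> {}" for A B :: "real set"
  proof (rule hs_dim_add_le)
    fix s t :: real assume "s \<ge> 0" "t \<ge> 0" and top: "hs_measure s A * hs_measure t B = top"
    then have "ennreal (\<gamma> * inverse \<xi>) * top \<le> hs_measure (s + t) (A \<times> B)"
      using b[OF reg, of s t] by (simp add: mult.assoc)
    moreover have "ennreal (\<gamma> * inverse \<xi>) * top = top"
      using assms(4) by (simp add: \<gamma> ennreal_mult_top)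
    ultimately show "hs_measure (s + t) (A \<times> B) = top"
      by (simp add: top_unique)
  qed fact+
  show ?thesis
  proof (intro conjI allI impI)
    fix F :: "(real \<times> real) set" and A :: "real set" and s t c :: real
    assume "s \<ge> 0" "t \<ge> 0" "\<forall>x\<in>A. enn2ereal (hs_measure t (vsection F x)) > ereal c" "xi_regular \<xi> F"
    then show "enn2ereal (hs_measure (s + t) F) \<ge> ereal (\<gamma> * inverse \<xi> * c) * enn2ereal (hs_measure s A)"
      by (intro a) simp_all
  qed (fact b dim)+
qed

end
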